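(* Let $K\subset\mathbb{R}^n$ be a nonempty closed convex set and let $P:\mathbb{R}^n\to\mathbb{R}^n$ be a polynomial map of degree $d$, where $d$ is a positive integer. If $(K,P)$ is an $R_0$-pair and $\mathrm{SOL}(K,P)\neq\emptyset$, then the set-valued map $\mathrm{SOL}:\mathcal{P}_d\rightrightarrows\mathbb{R}^n$, $Q\mapsto\mathrm{SOL}(K,Q)$, is upper semicontinuous at $P$.
   Context: For a nonempty closed convex set $K\subset\mathbb{R}^n$ and a continuous map $F:\mathbb{R}^n\to\mathbb{R}^n$, $\mathrm{SOL}(K,F)$ denotes the set of $x\in K$ such that $\langle F(x),y-x\rangle\ge 0$ for all $y\in K$. The asymptotic cone of $K$ is $K^\infty=\{v\in\mathbb{R}^n:\exists t_k\to\infty,\ \exists x_k\in K,\ x_k/t_k\to v\}$ (the recession cone of $K$). For a polynomial map $P=(P_1,\dots,P_n)$, its degree is $d=\max_l\deg P_l$, and $P^\infty=(P_1^\infty,\dots,P_n^\infty)$, where $P_l^\infty$ is the homogeneous component of degree $d$ of $P_l$. The pair $(K,P)$ is an $R_0$-pair if $\mathrm{SOL}(K^\infty,P^\infty)=\{0\}$. $\mathcal{P}_d$ is the finite-dimensional vector space of polynomial maps $\mathbb{R}^n\to\mathbb{R}^n$ all of whose components have degree at most $d$, normed by the Frobenius norm of the matrix of coefficients. A set-valued map $\Psi:X\rightrightarrows Y$ between topological spaces is upper semicontinuous at $x\in X$ if for every open $V\subset Y$ with $\Psi(x)\subset V$ there is a neighborhood $U$ of $x$ such that $\Psi(x')\subset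 V$ for all $x'\in U$. *)

theory Defs
  imports "HOL-Analysis.Analysis" "HOL-Library.Poly_Mapping"
begin

definition SOL :: "('a::real_inner) set \<Rightarrow> ('a \<Rightarrow> 'a) \<Rightarrow> 'a set" where
  "SOL K F = {x \<in> K. \<forall>y\<in>K. F x \<bullet> (y - x) \<ge> 0}"

definition asymptotic_cone :: "('a::real_normed_vector) set \<Rightarrow> 'a set" where
  "asymptotic_cone K =
     {v. \<exists>(t :: nat \<Rightarrow> real) x. filterlim t at_top sequentially \<and> (\<forall>k. x k \<in> K) \<and>
           (\<lambda>k. x k /\<^sub>R t k) \<longlonglongrightarrow> v}"

text \<open>
  A real polynomial in the variables indexed by \<open>'n\<close> is given by its finitely supported family of
  coefficients, indexed by exponent vectors; a polynomial map of \<open>real ^ 'n\<close> is a vector of such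
  polynomials. As the field is infinite, this is the same as giving the function
  \<open>poly_map_eval P\<close> below.
\<close>

type_synonym 'n monomial = "'n \<Rightarrow>\<^sub>0 nat"
type_synonym 'n real_mpoly = "'n monomial \<Rightarrow>\<^sub>0 real"
type_synonym 'n poly_map = "('n real_mpoly) ^ 'n"

definition monomial_degree :: "('n::finite) monomial \<Rightarrow> nat" where
  "monomial_degree \<alpha> = (\<Sum>i\<in>UNIV. Poly_Mapping.lookup \<alpha> i)"

definition mpoly_eval :: "('n::finite) real_mpoly \<Rightarrow> real ^ 'n \<Rightarrow> real" where
  "mpoly_eval p x =
     (\<Sum>\<alpha>\<in>Poly_Mapping.keys p. Poly_Mapping.lookup p \<alpha> *
       (\<Prod>i\<in>UNIV. (x $ i) ^ Poly_Mapping.lookup \<alpha> i))"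

text \<open>Total degree; the zero polynomial gets degree \<open>0\<close>.\<close>

definition mpoly_degree :: "('n::finite) real_mpoly \<Rightarrow> nat" where
  "mpoly_degree p = Max (insert 0 (monomial_degree ` Poly_Mapping.keys p))"

definition homogeneous_component :: "nat \<Rightarrow> ('n::finite) real_mpoly \<Rightarrow> 'n real_mpoly" where
  "homogeneous_component d p =
     (\<Sum>\<alpha> | \<alpha> \<in> Poly_Mapping.keys p \<and> monomial_degree \<alpha> = d.
        Poly_Mapping.single \<alpha> (Poly_Mapping.lookup p \<alpha>))"

definition poly_map_eval :: "('n::finite) poly_map \<Rightarrow> real ^ 'n \<Rightarrow> real ^ 'n" where
  "poly_map_eval P x = (\<chi> l. mpoly_eval (P $ l) x)"

definition poly_map_degree :: "('n::finite) poly_map \<Rightarrow> nat" where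
  "poly_map_degree P = Max (range (\<lambda>l. mpoly_degree (P $ l)))"

text \<open>
  The homogeneous component is taken at the degree of the whole map, so a \<open>P $ l\<close> of smaller degree
  contributes \<open>0\<close>.
\<close>

definition leading_part :: "('n::finite) poly_map \<Rightarrow> 'n poly_map" where
  "leading_part P = (\<chi> l. homogeneous_component (poly_map_degree P) (P $ l))"

definition R0_pair :: "(real ^ 'n::finite) set \<Rightarrow> 'n poly_map \<Rightarrow> bool" where
  "R0_pair K P \<longleftrightarrow> SOL (asymptotic_cone K) (poly_map_eval (leading_part P)) = {0}"

definition poly_maps :: "nat \<Rightarrow> ('n::finite) poly_map set" where
  "poly_maps d = {P. \<forall>l. mpoly_degree (P $ l) \<le> d}"

text \<open>Entries of the coefficient matrix outside the supports vanish and are left out.\<close>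

definition frobenius_norm :: "('n::finite) poly_map \<Rightarrow> real" where
  "frobenius_norm P =
     sqrt (\<Sum>l\<in>UNIV. \<Sum>\<alpha>\<in>Poly_Mapping.keys (P $ l). (Poly_Mapping.lookup (P $ l) \<alpha>)\<^sup>2)"

definition poly_maps_topology :: "nat \<Rightarrow> ('n::finite) poly_map topology" where
  "poly_maps_topology d =
     Metric_space.mtopology (poly_maps d) (\<lambda>P Q. frobenius_norm (P - Q))"

definition upper_semicontinuous_at ::
    "'a topology \<Rightarrow> 'b topology \<Rightarrow> ('a \<Rightarrow> 'b set) \<Rightarrow> 'a \<Rightarrow> bool" where
  "upper_semicontinuous_at X Y \<Psi> x \<longleftrightarrow>
     (\<forall>V. openin Y V \<and> \<Psi> x \<subseteq> V \<longrightarrow>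
        (\<exists>U. openin X U \<and> x \<in> U \<and> (\<forall>x'\<in>U. \<Psi> x' \<subseteq> V)))"

lemma lookup_homogeneous_component:
  "Poly_Mapping.lookup (homogeneous_component d p) \<alpha> =
     (if monomial_degree \<alpha> = d then Poly_Mapping.lookup p \<alpha> else 0)"
proof -
  have "Poly_Mapping.lookup (homogeneous_component d p) \<alpha> =
      (\<Sum>\<beta> | \<beta> \<in> Poly_Mapping.keys p \<and> monomial_degree \<beta> = d.
         if \<beta> = \<alpha> then Poly_Mapping.lookup p \<beta> else 0)"
    by (simp add: homogeneous_component_def lookup_sum lookup_single when_def)
  also have "\<dots> = (if \<alpha> \<in> {\<beta>. \<beta> \<in> Poly_Mapping.keys p \<and> monomial_degree \<beta> = d}
      then Poly_Mapping.lookup p \<alpha> else 0)"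
    by (subst sum.delta) auto
  finally show ?thesis
    by (auto simp: in_keys_iff)
qed

lemma frobenius_norm_eq_L2_set:
  assumes "finite S" and "\<And>l. Poly_Mapping.keys (P $ l) \<subseteq> S"
  shows "frobenius_norm P = L2_set (\<lambda>(l, \<alpha>). Poly_Mapping.lookup (P $ l) \<alpha>) (UNIV \<times> S)"
proof -
  have "(\<Sum>\<alpha>\<in>Poly_Mapping.keys (P $ l). (Poly_Mapping.lookup (P $ l) \<alpha>)\<^sup>2) =
      (\<Sum>\<alpha>\<in>S. (Poly_Mapping.lookup (P $ l) \<alpha>)\<^sup>2)" for l
    by (rule sum.mono_neutral_left) (use assms in \<open>auto simp: in_keys_iff\<close>)
  then show ?thesis
    by (simp add: frobenius_norm_def L2_set_def sum.cartesian_product case_prod_unfold)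
qed

text \<open>So \<open>poly_maps_topology d\<close> is the topology of a genuine metric.\<close>

lemma Metric_space_poly_maps:
  "Metric_space (poly_maps d) (\<lambda>P Q. frobenius_norm (P - Q :: ('n::finite) poly_map))"
proof
  fix P Q R :: "'n poly_map"
  define S where "S = (\<Union>l. Poly_Mapping.keys (P $ l) \<union> Poly_Mapping.keys (Q $ l) \<union>
    Poly_Mapping.keys (R $ l))"
  have fin: "finite S"
    by (simp add: S_def)
  have sub: "Poly_Mapping.keys ((A - B) $ l) \<subseteq> S" if "A \<in> {P, Q, R}" "B \<in> {P, Q, R}" for A B l
  proof -
    have "Poly_Mapping.keys (A $ l) \<union> Poly_Mapping.keys (B $ l) \<subseteq> S"
      using that by (auto simp: S_def)
    then show ?thesis
      using keys_diff[of "A $ l" "B $ l"] by auto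
  qed
  note L2 = frobenius_norm_eq_L2_set[OF fin sub]
  show "0 \<le> frobenius_norm (P - Q)"
    by (simp add: frobenius_norm_def sum_nonneg)
  show "frobenius_norm (P - Q) = frobenius_norm (Q - P)"
    by (simp add: L2 L2_set_def lookup_minus power2_commute case_prod_unfold)
  show "frobenius_norm (P - Q) = 0 \<longleftrightarrow> P = Q"
  proof
    assume "frobenius_norm (P - Q) = 0"
    then have "\<forall>l. \<forall>\<alpha>\<in>S. Poly_Mapping.lookup ((P - Q) $ l) \<alpha> = 0"
      using fin by (simp add: L2 L2_set_eq_0_iff)
    moreover have "Poly_Mapping.lookup ((P - Q) $ l) \<alpha> = 0" if "\<alpha> \<notin> S" for l \<alpha>
      using sub[of P Q l] that by (auto simp: in_keys_iff)
    ultimately have "Poly_Mapping.lookup ((P - Q) $ l) \<alpha> = 0" for l \<alpha>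
      by blast
    then show "P = Q"
      by (simp add: vec_eq_iff poly_mapping_eq_iff fun_eq_iff lookup_minus)
  qed (simp add: frobenius_norm_def)
  have "frobenius_norm (P - R) =
      L2_set (\<lambda>x. (case x of (l, \<alpha>) \<Rightarrow> Poly_Mapping.lookup ((P - Q) $ l) \<alpha>) +
        (case x of (l, \<alpha>) \<Rightarrow> Poly_Mapping.lookup ((Q - R) $ l) \<alpha>)) (UNIV \<times> S)"
    by (simp add: L2 lookup_minus case_prod_unfold)
  also have "\<dots> \<le> frobenius_norm (P - Q) + frobenius_norm (Q - R)"
    by (simp add: L2 L2_set_triangle_ineq)
  finally show "frobenius_norm (P - R) \<le> frobenius_norm (P - Q) + frobenius_norm (Q - R)" .
qed

lemma poly_maps_iff: "P \<in> poly_maps d \<longleftrightarrow> poly_map_degree P \<le> d"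
  by (auto simp: poly_maps_def poly_map_degree_def)

end

theory Submission
  imports Defs
begin

text \<open>
  Upper semicontinuity is a compactness argument with two ingredients. The graph of
  \<open>Q \<mapsto> SOL K Q\<close> is closed, because evaluation of polynomial maps of degree at most \<open>d\<close> is jointly
  continuous in the coefficients and the point (\<open>SOL_closed_graph\<close>). And for an \<open>R\<^sub>0\<close>-pair the
  solutions of all problems near \<open>P\<close> lie in one common ball (\<open>R0_pair_locally_bounded\<close>).
  Given both, solutions of problems tending to \<open>P\<close> that avoid an open set containing \<open>SOL K P\<close>
  would accumulate at a solution for \<open>P\<close> outside that set.

  The \<open>R\<^sub>0\<close> property gives the common ball as follows. If \<open>Q\<^sub>k\<close> tends to \<open>P\<close> and solutions \<open>x\<^sub>k\<close> for
  \<open>Q\<^sub>k\<close> have norms tending to infinity, then the directions \<open>x\<^sub>k / \<bar>x\<^sub>k\<bar>\<close> accumulate at a unit vector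
  \<open>v\<close> of the asymptotic cone, and \<open>Q\<^sub>k(x\<^sub>k) / \<bar>x\<^sub>k\<bar>\<^sup>d\<close> tends along a subsequence to the leading part
  of \<open>P\<close> at \<open>v\<close>: terms of degree below \<open>d\<close> are killed by the scaling
  (\<open>poly_map_eval_rescaled_tendsto\<close>). Dividing the variational inequality for \<open>x\<^sub>k\<close> by
  \<open>\<bar>x\<^sub>k\<bar>\<^sup>d\<^sup>+\<^sup>1\<close>, tested at a fixed point of \<open>K\<close> and at \<open>x\<^sub>k + \<bar>x\<^sub>k\<bar> w\<close> for \<open>w\<close> in the cone, shows
  that \<open>v\<close> is a nonzero solution of the asymptotic problem, which the \<open>R\<^sub>0\<close> property forbids.
\<close>

section \<open>Convergence of polynomial maps of bounded degree\<close>

lemma finite_monomials_of_degree_le: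
  "finite {\<alpha> :: ('n::finite) monomial. monomial_degree \<alpha> \<le> d}"
proof -
  have "Poly_Mapping.lookup ` {\<alpha> :: 'n monomial. monomial_degree \<alpha> \<le> d} \<subseteq> UNIV \<rightarrow>\<^sub>E {..d}"
  proof (intro image_subsetI PiE_I)
    fix \<alpha> :: "'n monomial" and i
    assume "\<alpha> \<in> {\<alpha>. monomial_degree \<alpha> \<le> d}"
    moreover have "Poly_Mapping.lookup \<alpha> i \<le> monomial_degree \<alpha>"
      unfolding monomial_degree_def by (rule member_le_sum) auto
    ultimately show "Poly_Mapping.lookup \<alpha> i \<in> {..d}"
      by simp
  qed simp
  then have "finite (Poly_Mapping.lookup ` {\<alpha> :: 'n monomial. monomial_degree \<alpha> \<le> d})"
    by (rule finite_subset) (simp add: finite_PiE)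
  then show ?thesis
    by (rule finite_imageD) (simp add: inj_on_def lookup_inject)
qed

lemma monomial_degree_le_mpoly_degree:
  "\<alpha> \<in> Poly_Mapping.keys p \<Longrightarrow> monomial_degree \<alpha> \<le> mpoly_degree p"
  by (simp add: mpoly_degree_def)

text \<open>
  Polynomials of degree at most \<open>d\<close> with varying supports are all sums over this one finite index
  set, so that limits can be taken term by term.
\<close>

lemma mpoly_eval_eq_sum_degree_le:
  assumes "mpoly_degree p \<le> d"
  shows "mpoly_eval p x = (\<Sum>\<alpha> | monomial_degree \<alpha> \<le> d.
    Poly_Mapping.lookup p \<alpha> * (\<Prod>i\<in>UNIV. (x $ i) ^ Poly_Mapping.lookup \<alpha> i))"
  unfolding mpoly_eval_def
proof (rule sum.mono_neutral_left)
  show "Poly_Mapping.keys p \<subseteq> {\<alpha>. monomial_degree \<alpha> \<le> d}"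
    using assms monomial_degree_le_mpoly_degree le_trans by blast
qed (simp_all add: finite_monomials_of_degree_le in_keys_iff)

lemma mpoly_degree_homogeneous_component_le: "mpoly_degree (homogeneous_component d p) \<le> d"
  by (auto simp: mpoly_degree_def in_keys_iff lookup_homogeneous_component split: if_splits)

lemma abs_lookup_le_frobenius_norm:
  "\<bar>Poly_Mapping.lookup (P $ l) \<alpha>\<bar> \<le> frobenius_norm P"
proof -
  define S where "S = insert \<alpha> (\<Union>l. Poly_Mapping.keys (P $ l))"
  have S: "finite S" "\<And>l. Poly_Mapping.keys (P $ l) \<subseteq> S" "\<alpha> \<in> S"
    by (auto simp: S_def)
  have "\<bar>Poly_Mapping.lookup (P $ l) \<alpha>\<bar>
      = L2_set (\<lambda>(l, \<alpha>). Poly_Mapping.lookup (P $ l) \<alpha>) {(l, \<alpha>)}"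
    by simp
  also have "\<dots> \<le> L2_set (\<lambda>(l, \<alpha>). Poly_Mapping.lookup (P $ l) \<alpha>) (UNIV \<times> S)"
    unfolding L2_set_def by (rule real_sqrt_le_mono, rule sum_mono2) (use S in auto)
  finally show ?thesis
    by (simp add: frobenius_norm_eq_L2_set[OF S(1,2)])
qed

lemma frobenius_norm_tendsto_0I:
  assumes "\<And>k. frobenius_norm (A k) < inverse (real (Suc k))"
  shows "(\<lambda>k. frobenius_norm (A k)) \<longlonglongrightarrow> 0"
proof (rule tendsto_sandwich[OF _ _ tendsto_const LIMSEQ_inverse_real_of_nat])
  show "\<forall>\<^sub>F k in sequentially. 0 \<le> frobenius_norm (A k)"
    by (simp add: frobenius_norm_def sum_nonneg)
  show "\<forall>\<^sub>F k in sequentially. frobenius_norm (A k) \<le> inverse (real (Suc k))"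
    using assms by (simp add: less_imp_le)
qed

lemma lookup_tendsto_of_frobenius_norm:
  assumes "(\<lambda>k. frobenius_norm (P - Q k)) \<longlonglongrightarrow> 0"
  shows "(\<lambda>k. Poly_Mapping.lookup (Q k $ l) \<alpha>) \<longlonglongrightarrow> Poly_Mapping.lookup (P $ l) \<alpha>"
proof -
  have "(\<lambda>k. Poly_Mapping.lookup (P $ l) \<alpha> - Poly_Mapping.lookup (Q k $ l) \<alpha>) \<longlonglongrightarrow> 0"
    by (rule tendsto_rabs_zero_cancel, rule Lim_null_comparison[OF _ assms])
      (use abs_lookup_le_frobenius_norm[of "P - Q _"] in \<open>simp add: lookup_minus\<close>)
  from tendsto_diff[OF tendsto_const[of "Poly_Mapping.lookup (P $ l) \<alpha>"] this] show ?thesis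
    by simp
qed

lemma poly_map_eval_tendsto:
  fixes Q :: "nat \<Rightarrow> ('n::finite) poly_map"
  assumes P: "P \<in> poly_maps d" and Q: "\<And>k. Q k \<in> poly_maps d"
    and lim: "(\<lambda>k. frobenius_norm (P - Q k)) \<longlonglongrightarrow> 0" and x: "x \<longlonglongrightarrow> a"
  shows "(\<lambda>k. poly_map_eval (Q k) (x k)) \<longlonglongrightarrow> poly_map_eval P a"
proof (rule vec_tendstoI)
  fix l
  have deg: "mpoly_degree (P $ l) \<le> d" "\<And>k. mpoly_degree (Q k $ l) \<le> d"
    using P Q by (auto simp: poly_maps_def)
  show "(\<lambda>k. poly_map_eval (Q k) (x k) $ l) \<longlonglongrightarrow> poly_map_eval P a $ l"
    unfolding poly_map_eval_def vec_lambda_beta mpoly_eval_eq_sum_degree_le[OF deg(1)]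
      mpoly_eval_eq_sum_degree_le[OF deg(2)]
    by (intro tendsto_intros lookup_tendsto_of_frobenius_norm lim x)
qed

lemma monomial_eval_scaled:
  fixes u :: "real ^ 'n::finite"
  shows "(\<Prod>i\<in>UNIV. (r * u $ i) ^ Poly_Mapping.lookup \<alpha> i)
    = r ^ monomial_degree \<alpha> * (\<Prod>i\<in>UNIV. (u $ i) ^ Poly_Mapping.lookup \<alpha> i)"
  by (simp add: power_mult_distrib prod.distrib monomial_degree_def power_sum)

text \<open>
  After division by \<open>r\<^sup>d\<close> a monomial of degree \<open>e \<le> d\<close> carries the factor \<open>r\<^sup>e / r\<^sup>d\<close>, which tends to
  \<open>1\<close> for \<open>e = d\<close> and to \<open>0\<close> otherwise. Thus only the homogeneous part of degree \<open>d\<close> survives.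
\<close>

lemma poly_map_eval_rescaled_tendsto:
  fixes Q :: "nat \<Rightarrow> ('n::finite) poly_map"
  assumes P: "poly_map_degree P = d" and Q: "\<And>k. Q k \<in> poly_maps d"
    and lim: "(\<lambda>k. frobenius_norm (P - Q k)) \<longlonglongrightarrow> 0"
    and r: "filterlim r at_top sequentially" and r_pos: "\<And>k. r k > 0" and u: "u \<longlonglongrightarrow> v"
  shows "(\<lambda>k. poly_map_eval (Q k) (r k *\<^sub>R u k) /\<^sub>R r k ^ d)
    \<longlonglongrightarrow> poly_map_eval (leading_part P) v"
proof (rule vec_tendstoI)
  fix l
  let ?m = "\<lambda>\<alpha> y. \<Prod>i\<in>UNIV. (y $ i) ^ Poly_Mapping.lookup \<alpha> i"
  have factor: "(\<lambda>k. r k ^ e / r k ^ d) \<longlonglongrightarrow> (if e = d then 1 else 0)" if "e \<le> d" for e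
  proof (cases "e = d")
    case False
    have "(\<lambda>k. inverse (r k ^ (d - e))) \<longlonglongrightarrow> 0"
      by (rule tendsto_inverse_0_at_top[OF filterlim_pow_at_top[OF _ r]])
        (use False that in simp)
    moreover have "inverse (r k ^ (d - e)) = r k ^ e / r k ^ d" for k
      using r_pos[of k] that by (simp add: power_diff field_simps)
    ultimately show ?thesis
      using False by simp
  next
    case True
    have "r k ^ e / r k ^ d = 1" for k
      using r_pos[of k] True by simp
    then show ?thesis
      using True by simp
  qed
  have deg: "mpoly_degree (Q k $ l) \<le> d" for k
    using Q by (auto simp: poly_maps_def)
  have "(poly_map_eval (Q k) (r k *\<^sub>R u k) /\<^sub>R r k ^ d) $ l =
      (\<Sum>\<alpha> | monomial_degree \<alpha> \<le> d. Poly_Mapping.lookup (Q k $ l) \<alpha> *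
        (r k ^ monomial_degree \<alpha> / r k ^ d) * ?m \<alpha> (u k))" for k
    unfolding poly_map_eval_def vector_scaleR_component vec_lambda_beta real_scaleR_def
      mpoly_eval_eq_sum_degree_le[OF deg] monomial_eval_scaled
    by (simp add: sum_distrib_left divide_inverse mult_ac)
  moreover have "(\<lambda>k. \<Sum>\<alpha> | monomial_degree \<alpha> \<le> d. Poly_Mapping.lookup (Q k $ l) \<alpha> *
        (r k ^ monomial_degree \<alpha> / r k ^ d) * ?m \<alpha> (u k))
      \<longlonglongrightarrow> (\<Sum>\<alpha> | monomial_degree \<alpha> \<le> d. Poly_Mapping.lookup (P $ l) \<alpha> *
        (if monomial_degree \<alpha> = d then 1 else 0) * ?m \<alpha> v)"
  proof (rule tendsto_sum)
    fix \<alpha> :: "'n monomial"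
    assume "\<alpha> \<in> {\<alpha>. monomial_degree \<alpha> \<le> d}"
    then show "(\<lambda>k. Poly_Mapping.lookup (Q k $ l) \<alpha> * (r k ^ monomial_degree \<alpha> / r k ^ d) *
        ?m \<alpha> (u k))
      \<longlonglongrightarrow> Poly_Mapping.lookup (P $ l) \<alpha> * (if monomial_degree \<alpha> = d then 1 else 0) * ?m \<alpha> v"
      by (intro tendsto_mult factor tendsto_prod tendsto_power tendsto_vec_nth
          lookup_tendsto_of_frobenius_norm lim u) simp
  qed
  moreover have "(\<Sum>\<alpha> | monomial_degree \<alpha> \<le> d. Poly_Mapping.lookup (P $ l) \<alpha> *
        (if monomial_degree \<alpha> = d then 1 else 0) * ?m \<alpha> v)
      = poly_map_eval (leading_part P) v $ l"
    unfolding poly_map_eval_def leading_part_def vec_lambda_beta P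
      mpoly_eval_eq_sum_degree_le[OF mpoly_degree_homogeneous_component_le]
    by (rule sum.cong) (auto simp: lookup_homogeneous_component)
  ultimately show "(\<lambda>k. (poly_map_eval (Q k) (r k *\<^sub>R u k) /\<^sub>R r k ^ d) $ l)
      \<longlonglongrightarrow> poly_map_eval (leading_part P) v $ l"
    by simp
qed

section \<open>Local boundedness and closed graph of the solution map\<close>

text \<open>
  If \<open>w\<close> is the limit of \<open>y\<^sub>k / t\<^sub>k\<close>, then \<open>x + s w\<close> is the limit of the convex combinations of \<open>x\<close> and
  \<open>y\<^sub>k\<close> with weight \<open>s / t\<^sub>k\<close> on \<open>y\<^sub>k\<close>.
\<close>

lemma add_asymptotic_direction_mem:
  fixes K :: "('a::real_normed_vector) set"
  assumes "closed K" "convex K" "x \<in> K" "w \<in> asymptotic_cone K" "s \<ge> 0"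
  shows "x + s *\<^sub>R w \<in> K"
proof -
  obtain t :: "nat \<Rightarrow> real" and y where t: "filterlim t at_top sequentially"
    and y: "\<And>k. y k \<in> K" and w: "(\<lambda>k. y k /\<^sub>R t k) \<longlonglongrightarrow> w"
    using assms(4) by (auto simp: asymptotic_cone_def)
  have inv: "(\<lambda>k. inverse (t k)) \<longlonglongrightarrow> 0"
    by (rule tendsto_inverse_0_at_top[OF t])
  have "(\<lambda>k. (1 - s * inverse (t k)) *\<^sub>R x + s *\<^sub>R (y k /\<^sub>R t k))
      \<longlonglongrightarrow> (1 - s * 0) *\<^sub>R x + s *\<^sub>R w"
    by (intro tendsto_intros inv w)
  moreover have "\<forall>\<^sub>F k in sequentially.
      (1 - s * inverse (t k)) *\<^sub>R x + s *\<^sub>R (y k /\<^sub>R t k) \<in> K"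
  proof -
    have "\<forall>\<^sub>F k in sequentially. t k \<ge> s + 1"
      using t by (simp add: filterlim_at_top)
    then show ?thesis
    proof eventually_elim
      case (elim k)
      then have "0 \<le> s * inverse (t k)" "s * inverse (t k) \<le> 1"
        using \<open>s \<ge> 0\<close> by (auto simp: field_simps)
      then show ?case
        using convexD_alt[OF \<open>convex K\<close> \<open>x \<in> K\<close> y[of k], of "s * inverse (t k)"] by simp
    qed
  qed
  ultimately have "(1 - s * 0) *\<^sub>R x + s *\<^sub>R w \<in> K"
    using \<open>closed K\<close> by (intro Lim_in_closed_set) auto
  then show ?thesis
    by simp
qed

lemma SOL_closed_graph:
  fixes Q :: "nat \<Rightarrow> ('n::finite) poly_map"
  assumes "closed K" and "P \<in> poly_maps d" and "\<And>k. Q k \<in> poly_maps d"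
    and "(\<lambda>k. frobenius_norm (P - Q k)) \<longlonglongrightarrow> 0"
    and sol: "\<And>k. x k \<in> SOL K (poly_map_eval (Q k))" and x: "x \<longlonglongrightarrow> a"
  shows "a \<in> SOL K (poly_map_eval P)"
proof -
  have "a \<in> K"
    using closed_sequentially[OF \<open>closed K\<close> _ x] sol by (auto simp: SOL_def)
  moreover have "poly_map_eval P a \<bullet> (y - a) \<ge> 0" if "y \<in> K" for y
  proof (rule tendsto_lowerbound)
    show "(\<lambda>k. poly_map_eval (Q k) (x k) \<bullet> (y - x k)) \<longlonglongrightarrow> poly_map_eval P a \<bullet> (y - a)"
      by (intro tendsto_inner tendsto_diff tendsto_const x poly_map_eval_tendsto[where d = d] assms)
    show "\<forall>\<^sub>F k in sequentially. 0 \<le> poly_map_eval (Q k) (x k) \<bullet> (y - x k)"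
      using sol that by (auto simp: SOL_def)
  qed simp
  ultimately show ?thesis
    by (simp add: SOL_def)
qed

text \<open>
  Dividing the variational inequality for \<open>x\<^sub>k\<close> by \<open>\<bar>x\<^sub>k\<bar>\<^sup>d\<^sup>+\<^sup>1\<close> separates the asymptotic one into two
  parts: a fixed \<open>y \<in> K\<close> becomes negligible and leaves \<open>P\<^sup>\<infinity>(v) \<bullet> (- v) \<ge> 0\<close>, and the test point
  \<open>x\<^sub>k + \<bar>x\<^sub>k\<bar> w\<close> leaves \<open>P\<^sup>\<infinity>(v) \<bullet> w \<ge> 0\<close>.
\<close>

lemma limit_direction_mem_SOL_leading_part:
  fixes Q :: "nat \<Rightarrow> ('n::finite) poly_map"
  assumes "closed K" "convex K" and "poly_map_degree P = d" and "\<And>k. Q k \<in> poly_maps d"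
    and "(\<lambda>k. frobenius_norm (P - Q k)) \<longlonglongrightarrow> 0"
    and sol: "\<And>k. x k \<in> SOL K (poly_map_eval (Q k))"
    and r: "filterlim (\<lambda>k. norm (x k)) at_top sequentially" and nz: "\<And>k. x k \<noteq> 0"
    and v: "(\<lambda>k. x k /\<^sub>R norm (x k)) \<longlonglongrightarrow> v"
  shows "v \<in> SOL (asymptotic_cone K) (poly_map_eval (leading_part P))"
proof -
  let ?F = "poly_map_eval (leading_part P)"
  let ?f = "\<lambda>k. poly_map_eval (Q k) (x k) /\<^sub>R norm (x k) ^ d"
  have xK: "x k \<in> K" for k
    using sol by (auto simp: SOL_def)
  have vi: "0 \<le> poly_map_eval (Q k) (x k) \<bullet> (y - x k)" if "y \<in> K" for k y
    using sol[of k] that by (auto simp: SOL_def)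
  have f: "?f \<longlonglongrightarrow> ?F v"
    using poly_map_eval_rescaled_tendsto[OF assms(3-5) r _ v] nz by simp
  have "v \<in> asymptotic_cone K"
    using r v xK by (auto simp: asymptotic_cone_def)
  moreover have "?F v \<bullet> (w - v) \<ge> 0" if w: "w \<in> asymptotic_cone K" for w
  proof -
    have "?F v \<bullet> w \<ge> 0"
    proof (rule tendsto_lowerbound)
      show "(\<lambda>k. ?f k \<bullet> w) \<longlonglongrightarrow> ?F v \<bullet> w"
        by (intro tendsto_inner tendsto_const f)
      have "0 \<le> ?f k \<bullet> w" for k
      proof -
        have "x k + norm (x k) *\<^sub>R w \<in> K"
          by (rule add_asymptotic_direction_mem) (use assms xK w in auto)
        from vi[OF this, of k] have "0 \<le> poly_map_eval (Q k) (x k) \<bullet> w"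
          using nz[of k] by (simp add: zero_le_mult_iff)
        then show ?thesis
          by simp
      qed
      then show "\<forall>\<^sub>F k in sequentially. 0 \<le> ?f k \<bullet> w"
        by simp
    qed simp
    \<comment> \<open>Any point of \<open>K\<close> serves as the fixed test point; the first term of the sequence is one.\<close>
    moreover have "?F v \<bullet> (0 - v) \<ge> 0"
    proof (rule tendsto_lowerbound)
      have "(\<lambda>k. inverse (norm (x k))) \<longlonglongrightarrow> 0"
        by (rule tendsto_inverse_0_at_top[OF r])
      from tendsto_scaleR[OF this tendsto_const[of "x 0"]]
      have "(\<lambda>k. x 0 /\<^sub>R norm (x k)) \<longlonglongrightarrow> 0"
        by simp
      then show "(\<lambda>k. ?f k \<bullet> (x 0 /\<^sub>R norm (x k) - x k /\<^sub>R norm (x k))) \<longlonglongrightarrow> ?F v \<bullet> (0 - v)"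
        by (intro tendsto_inner tendsto_diff f v)
      have "0 \<le> ?f k \<bullet> (x 0 /\<^sub>R norm (x k) - x k /\<^sub>R norm (x k))" for k
        using vi[OF xK[of 0], of k] by (simp flip: scaleR_diff_right)
      then show "\<forall>\<^sub>F k in sequentially. 0 \<le> ?f k \<bullet> (x 0 /\<^sub>R norm (x k) - x k /\<^sub>R norm (x k))"
        by simp
    qed simp
    ultimately show ?thesis
      by (simp add: inner_diff_right)
  qed
  ultimately show ?thesis
    by (simp add: SOL_def)
qed

text \<open>
  The sequence of ever larger solutions is chosen so that its norms tend to infinity by themselves;
  its directions lie on the unit sphere, so a limit direction cannot be the zero solution.
\<close>

lemma R0_pair_locally_bounded:
  fixes K :: "(real ^ 'n::finite) set" and P :: "'n poly_map"
  assumes K: "closed K" "convex K" and P: "poly_map_degree P = d" and R0: "R0_pair K P"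
  shows "\<exists>e>0. \<exists>B. \<forall>Q\<in>poly_maps d. frobenius_norm (P - Q) < e \<longrightarrow>
    (\<forall>x\<in>SOL K (poly_map_eval Q). norm x \<le> B)"
proof (rule ccontr)
  assume neg: "\<not> ?thesis"
  have "\<exists>Q x. Q \<in> poly_maps d \<and> frobenius_norm (P - Q) < inverse (real (Suc k)) \<and>
      x \<in> SOL K (poly_map_eval Q) \<and> norm x > real k" for k
  proof -
    have "inverse (real (Suc k)) > 0"
      by simp
    with neg show ?thesis
      by (meson not_le)
  qed
  then obtain Q x where Q: "\<And>k. Q k \<in> poly_maps d"
    and close: "\<And>k. frobenius_norm (P - Q k) < inverse (real (Suc k))"
    and sol: "\<And>k. x k \<in> SOL K (poly_map_eval (Q k))" and large: "\<And>k. norm (x k) > real k"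
    by metis
  have lim: "(\<lambda>k. frobenius_norm (P - Q k)) \<longlonglongrightarrow> 0"
    by (rule frobenius_norm_tendsto_0I) (use close in simp)
  have inf: "filterlim (\<lambda>k. norm (x k)) at_top sequentially"
    by (rule filterlim_at_top_mono[OF filterlim_real_sequentially])
      (use large in \<open>auto intro!: always_eventually less_imp_le\<close>)
  have nz: "x k \<noteq> 0" for k
    using large[of k] by auto
  have unit: "\<forall>k. x k /\<^sub>R norm (x k) \<in> sphere 0 1"
    using nz by simp
  obtain v s where v: "v \<in> sphere 0 1" and s: "strict_mono s"
    and conv: "((\<lambda>k. x k /\<^sub>R norm (x k)) \<circ> s) \<longlonglongrightarrow> v"
    by (rule seq_compactE[OF compact_imp_seq_compact[OF compact_sphere] unit])
  have s_inf: "filterlim s sequentially sequentially"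
    by (rule filterlim_subseq[OF s])
  have "v \<in> SOL (asymptotic_cone K) (poly_map_eval (leading_part P))"
    by (rule limit_direction_mem_SOL_leading_part[of K P d "Q \<circ> s" "x \<circ> s"])
      (use K P Q sol nz conv filterlim_compose[OF lim s_inf] filterlim_compose[OF inf s_inf] in
        \<open>auto simp: comp_def\<close>)
  then have "v = 0"
    using R0 by (simp add: R0_pair_def)
  with v show False
    by simp
qed

section \<open>Upper semicontinuity of the solution map\<close>

theorem proposition3p2:
  fixes K :: "(real ^ 'n::finite) set" and P :: "'n poly_map" and d :: nat
  assumes "K \<noteq> {}" and "closed K" and "convex K"
    and "d > 0" and "poly_map_degree P = d"
    and "R0_pair K P"
    and "SOL K (poly_map_eval P) \<noteq> {}"
  shows "upper_semicontinuous_at (poly_maps_topology d) euclidean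
           (\<lambda>Q. SOL K (poly_map_eval Q)) P"
  unfolding upper_semicontinuous_at_def
proof (intro allI impI)
  interpret M: Metric_space "poly_maps d" "\<lambda>P Q. frobenius_norm (P - Q :: 'n poly_map)"
    by (rule Metric_space_poly_maps)
  fix V
  assume "openin euclidean V \<and> SOL K (poly_map_eval P) \<subseteq> V"
  then have V: "open V" "SOL K (poly_map_eval P) \<subseteq> V"
    by auto
  have P: "P \<in> poly_maps d"
    using assms(5) by (simp add: poly_maps_iff)
  obtain e B where e: "e > 0" and bound: "\<And>Q x. Q \<in> poly_maps d \<Longrightarrow>
      frobenius_norm (P - Q) < e \<Longrightarrow> x \<in> SOL K (poly_map_eval Q) \<Longrightarrow> norm x \<le> B"
    using R0_pair_locally_bounded[OF assms(2,3,5,6)] by blast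
  have "\<exists>\<delta>>0. \<forall>Q\<in>poly_maps d. frobenius_norm (P - Q) < \<delta> \<longrightarrow> SOL K (poly_map_eval Q) \<subseteq> V"
  proof (rule ccontr)
    assume neg: "\<not> ?thesis"
    have "\<exists>Q x. Q \<in> poly_maps d \<and> frobenius_norm (P - Q) < min e (inverse (real (Suc k))) \<and>
        x \<in> SOL K (poly_map_eval Q) \<and> x \<notin> V" for k
    proof -
      have "min e (inverse (real (Suc k))) > 0"
        using e by simp
      with neg show ?thesis
        by (meson subsetI)
    qed
    then obtain Q x where Q: "\<And>k. Q k \<in> poly_maps d"
      and close: "\<And>k. frobenius_norm (P - Q k) < min e (inverse (real (Suc k)))"
      and sol: "\<And>k. x k \<in> SOL K (poly_map_eval (Q k))" and out: "\<And>k. x k \<notin> V"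
      by metis
    have lim: "(\<lambda>k. frobenius_norm (P - Q k)) \<longlonglongrightarrow> 0"
      by (rule frobenius_norm_tendsto_0I) (use close in simp)
    have "compact (cball 0 B - V)"
      by (intro compact_diff compact_cball V)
    moreover have "\<forall>k. x k \<in> cball 0 B - V"
      using bound[OF Q _ sol] close out by simp
    ultimately obtain a s where a: "a \<in> cball 0 B - V" and s: "strict_mono s"
      and conv: "(x \<circ> s) \<longlonglongrightarrow> a"
      by (blast elim: seq_compactE[OF compact_imp_seq_compact])
    have "a \<in> SOL K (poly_map_eval P)"
      by (rule SOL_closed_graph[of K P d "Q \<circ> s" "x \<circ> s"])
        (use assms(2) P Q sol conv filterlim_compose[OF lim filterlim_subseq[OF s]] in
          \<open>auto simp: comp_def\<close>)
    with V(2) a show False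
      by auto
  qed
  then obtain \<delta> where "\<delta> > 0" and \<delta>: "\<And>Q. Q \<in> poly_maps d \<Longrightarrow> frobenius_norm (P - Q) < \<delta> \<Longrightarrow>
      SOL K (poly_map_eval Q) \<subseteq> V"
    by blast
  show "\<exists>U. openin (poly_maps_topology d) U \<and> P \<in> U \<and>
      (\<forall>Q\<in>U. SOL K (poly_map_eval Q) \<subseteq> V)"
  proof (intro exI conjI)
    show "openin (poly_maps_topology d) (M.mball P \<delta>)"
      by (simp add: poly_maps_topology_def M.openin_mball)
    show "P \<in> M.mball P \<delta>"
      using P \<open>\<delta> > 0\<close> by (simp only: M.centre_in_mball_iff)
    show "\<forall>Q\<in>M.mball P \<delta>. SOL K (poly_map_eval Q) \<subseteq> V"
      using \<delta> by auto
  qed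
qed

end
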